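(* Let $n$ be a natural number with $n\geq 27$ and let $\alpha\in[\frac{1}{3},1)$. Then $$A_{2n-1}(\alpha,1)\geq|A_{2n-1}(\alpha,e^{i\theta})|\quad\text{for all }\theta\in\left[-\pi,-\frac{2\pi}{3}\right]\cup\left[\frac{2\pi}{3},\pi\right].$$
   Context: For $\alpha>0$ and $x\in\mathbb{C}$ with $|x|=1$, the numbers $A_m(\alpha,x)$ are the coefficients of the Maclaurin expansion $$\frac{(1+xz)^\alpha}{1-z}=\sum_{m=0}^\infty A_m(\alpha,x)z^m,\qquad |z|<1,$$ where the power is the principal branch. Equivalently, $A_m(\alpha,x)=\sum_{k=0}^{m}\frac{(-\alpha)_k(-x)^k}{k!}$, where $(a)_0=1$ and $(a)_k=a(a+1)\cdots(a+k-1)$ for $k\ge 1$. In particular $A_m(\alpha,1)$ is real. *)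

theory Defs
  imports "HOL-Complex_Analysis.Complex_Analysis"
begin

definition A_coeff :: "nat \<Rightarrow> real \<Rightarrow> complex \<Rightarrow> complex" where
  "A_coeff m \<alpha> x =
     fps_nth (fps_expansion (\<lambda>z. (1 + x * z) powr complex_of_real \<alpha> / (1 - z)) 0) m"

lemma A_coeff_sums:
  assumes "norm x = 1" "norm z < 1"
  shows "(\<lambda>m. A_coeff m \<alpha> x * z ^ m) sums ((1 + x * z) powr complex_of_real \<alpha> / (1 - z))"
proof -
  have "1 + x * w \<notin> \<real>\<^sub>\<le>\<^sub>0" if "w \<in> ball 0 1" for w
  proof
    assume "1 + x * w \<in> \<real>\<^sub>\<le>\<^sub>0"
    then have "Re (x * w) \<le> -1"
      by (auto simp: complex_nonpos_Reals_iff)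
    then show False
      using abs_Re_le_cmod[of "x * w"] that assms(1) by (simp add: norm_mult)
  qed
  then have "(\<lambda>w. (1 + x * w) powr complex_of_real \<alpha> / (1 - w)) holomorphic_on ball 0 1"
    by (intro holomorphic_intros) auto
  from holomorphic_power_series[OF this, of z] assms(2) show ?thesis
    by (simp add: A_coeff_def fps_expansion_def)
qed

lemma A_coeff_has_fps_expansion:
  "(\<lambda>z. (1 + x * z) powr complex_of_real \<alpha> / (1 - z)) has_fps_expansion
     (fps_compose (fps_binomial (complex_of_real \<alpha>)) (fps_const x * fps_X)) * inverse (1 - fps_X)"
proof -
  have "((\<lambda>z. (1 + z) powr complex_of_real \<alpha>) \<circ> (\<lambda>z. x * z)) has_fps_expansion
          (fps_compose (fps_binomial (complex_of_real \<alpha>)) (fps_const x * fps_X))"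
    by (intro has_fps_expansion_compose fps_expansion_intros) auto
  moreover have "(\<lambda>z::complex. inverse (1 - z)) has_fps_expansion inverse (1 - fps_X)"
    by (intro fps_expansion_intros) auto
  ultimately show ?thesis
    unfolding divide_inverse o_def by (rule has_fps_expansion_mult)
qed

lemma A_coeff_eq_sum:
  "A_coeff m \<alpha> x = (\<Sum>k\<le>m. pochhammer (- complex_of_real \<alpha>) k * (- x) ^ k / fact k)"
proof -
  let ?f = "\<lambda>z. (1 + x * z) powr complex_of_real \<alpha> / (1 - z)"
  let ?F = "(fps_compose (fps_binomial (complex_of_real \<alpha>)) (fps_const x * fps_X)) *
              inverse (1 - fps_X)"
  have inv: "inverse (1 - fps_X) = (Abs_fps (\<lambda>_. 1) :: complex fps)"
    by (metis fps_inverse_gp' fps_inverse_idempotent fps_nth_Abs_fps one_neq_zero)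
  have "?f has_fps_expansion fps_expansion ?f 0"
    by (metis A_coeff_has_fps_expansion analytic_at_imp_has_fps_expansion_0
        has_fps_expansion_imp_analytic_0)
  then have "fps_expansion ?f 0 = ?F"
    using A_coeff_has_fps_expansion fps_expansion_unique_complex by blast
  then have "A_coeff m \<alpha> x = fps_nth ?F m"
    by (simp add: A_coeff_def)
  also have "\<dots> = (\<Sum>k\<le>m. pochhammer (- complex_of_real \<alpha>) k * (- x) ^ k / fact k)"
    unfolding inv
    by (auto simp: fps_mult_nth fps_compose_linear gbinomial_pochhammer atLeast0AtMost
          power_minus[of x] intro!: sum.cong)
  finally show ?thesis .
qed

lemma A_coeff_1_in_Reals: "A_coeff m \<alpha> 1 \<in> \<real>"
proof -
  have "pochhammer (- complex_of_real \<alpha>) k * (- 1) ^ k / fact k =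
          complex_of_real (pochhammer (- \<alpha>) k * (- 1) ^ k / fact k)" for k
    by (simp add: pochhammer_prod)
  then show ?thesis
    unfolding A_coeff_eq_sum by (simp only: sum_in_Reals Reals_of_real)
qed

end

theory Submission
  imports Defs
begin

text \<open>
  The moduli of the binomial coefficients telescope: \<open>\<bar>\<alpha> gchoose Suc k\<bar> = R k - R (Suc k)\<close> with
  \<open>R m = (\<Prod>j=1..m. 1 - \<alpha> / j)\<close>. Hence the \<open>m\<close>-th partial sum of the binomial series
  differs from \<open>(1 + x) powr \<alpha>\<close> by at most \<open>R m\<close> on the closed unit disc. For
  \<open>\<bar>\<theta>\<bar> \<ge> 2\<pi>/3\<close> one has \<open>\<bar>1 + x\<bar> \<le> 1\<close>, so \<open>\<bar>A\<^sub>m(\<alpha>,x)\<bar> \<le> 1 + R m\<close>. At \<open>x = 1\<close> the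
  series is alternating and its odd partial sums are at least \<open>1 + \<alpha> + \<alpha>(\<alpha>-1)/2 \<ge> 11/9\<close>. Finally,
  \<open>R m \<le> 2/9\<close> for \<open>m \<ge> 53\<close> since \<open>R m\<^sup>3 (m + 1)\<close> is decreasing in \<open>m\<close> for \<open>\<alpha> = 1/3\<close>.
\<close>

text \<open>This is \<open>pochhammer (1 - \<alpha>) m / fact m\<close>, that is, \<alpha> - 1
  choose m up to sign.\<close>

definition R :: "real \<Rightarrow> nat \<Rightarrow> real" where
  "R \<alpha> m = (\<Prod>j=1..m. 1 - \<alpha> / real j)"

lemma R_0 [simp]: "R \<alpha> 0 = 1"
  by (simp add: R_def)

lemma R_Suc: "R \<alpha> (Suc m) = R \<alpha> m * (1 - \<alpha> / real (Suc m))"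
  by (simp add: R_def)

lemma R_nonneg: "\<alpha> \<le> 1 \<Longrightarrow> 0 \<le> R \<alpha> m"
  unfolding R_def by (intro prod_nonneg) (auto simp: field_simps)

lemma R_antimono:
  assumes "\<beta> \<le> \<alpha>" "\<alpha> \<le> 1"
  shows "R \<alpha> m \<le> R \<beta> m"
  unfolding R_def using assms
  by (intro prod_mono) (auto simp: field_simps)

lemma gbinomial_Suc_eq_R_diff:
  "\<alpha> gchoose Suc k = (-1) ^ k * (R \<alpha> k - R \<alpha> (Suc k))"
proof (induction k)
  case 0
  then show ?case by (simp add: R_Suc)
next
  case (Suc k)
  \<comment> \<open>The two absorption identities share the right-hand side \<alpha> times (\<alpha>
    - 1 choose k + 1), which gives the ratio of consecutive coefficients.\<close>
  have "\<alpha> gchoose Suc (Suc k) = (\<alpha> gchoose Suc k) * ((\<alpha> - real (Suc k)) / real (Suc (Suc k)))"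
    using gbinomial_absorb_comp[of \<alpha> "Suc k"] gbinomial_absorption[of "Suc k" \<alpha>]
    by (simp add: field_simps)
  also have "\<dots> = (-1) ^ k * (R \<alpha> k - R \<alpha> (Suc k)) * ((\<alpha> - real (Suc k)) / real (Suc (Suc k)))"
    by (simp only: Suc.IH)
  also have "\<dots> = (-1) ^ Suc k * (R \<alpha> (Suc k) - R \<alpha> (Suc (Suc k)))"
    by (simp add: R_Suc divide_simps) (simp add: algebra_simps)
  finally show ?case .
qed

lemma gbinomial_of_real: "complex_of_real \<alpha> gchoose k = complex_of_real (\<alpha> gchoose k)"
  by (simp add: gbinomial_prod_rev)

lemma A_coeff_eq_binomial_sum:
  "A_coeff m \<alpha> x = (\<Sum>k<Suc m. (complex_of_real \<alpha> gchoose k) * x ^ k)"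
  unfolding A_coeff_eq_sum lessThan_Suc_atMost
  by (auto simp: gbinomial_pochhammer power_minus[of x] intro!: sum.cong)

lemma R_diff_nonneg:
  assumes "0 \<le> \<alpha>" "\<alpha> \<le> 1"
  shows "0 \<le> R \<alpha> k - R \<alpha> (Suc k)"
proof -
  have "R \<alpha> k - R \<alpha> (Suc k) = R \<alpha> k * (\<alpha> / real (Suc k))"
    by (simp add: R_Suc algebra_simps)
  then show ?thesis
    using assms R_nonneg[of \<alpha> k] by simp
qed

lemma R_diff_antimono:
  assumes "0 \<le> \<alpha>" "\<alpha> \<le> 1"
  shows "R \<alpha> (Suc k) - R \<alpha> (Suc (Suc k)) \<le> R \<alpha> k - R \<alpha> (Suc k)"
proof -
  have "R \<alpha> j - R \<alpha> (Suc j) = R \<alpha> j * (\<alpha> / real (Suc j))" for j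
    by (simp add: R_Suc algebra_simps)
  moreover have "R \<alpha> (Suc k) * (\<alpha> / real (Suc (Suc k))) \<le> R \<alpha> k * (\<alpha> / real (Suc k))"
    using assms R_diff_nonneg[OF assms, of k]
    by (intro mult_mono divide_left_mono) (auto simp: R_nonneg)
  ultimately show ?thesis by simp
qed

text \<open>Keeping \<open>R \<alpha> (m + p)\<close> in the bound makes it telescope in the
  induction on \<open>p\<close>.\<close>

lemma binomial_partial_sums_diff:
  assumes "0 \<le> \<alpha>" "\<alpha> \<le> 1" "norm x \<le> 1"
  shows "norm ((\<Sum>k<Suc (m + p). (complex_of_real \<alpha> gchoose k) * x ^ k) -
               (\<Sum>k<Suc m. (complex_of_real \<alpha> gchoose k) * x ^ k)) \<le> R \<alpha> m - R \<alpha> (m + p)"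
proof (induction p)
  case 0
  then show ?case by simp
next
  case (Suc p)
  let ?c = "\<lambda>k. (complex_of_real \<alpha> gchoose k) * x ^ k"
  have "norm (?c (Suc (m + p))) =
          (R \<alpha> (m + p) - R \<alpha> (Suc (m + p))) * norm x ^ Suc (m + p)"
    unfolding gbinomial_of_real gbinomial_Suc_eq_R_diff norm_mult norm_power norm_of_real
    using R_diff_nonneg[OF assms(1,2), of "m + p"] by (simp add: abs_mult power_abs)
  also have "\<dots> \<le> R \<alpha> (m + p) - R \<alpha> (Suc (m + p))"
    using R_diff_nonneg[OF assms(1,2), of "m + p"] power_le_one[OF norm_ge_zero assms(3), of "Suc (m + p)"]
    by (intro mult_left_le)
  finally have "norm (?c (Suc (m + p))) \<le> R \<alpha> (m + p) - R \<alpha> (Suc (m + p))" .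
  moreover have "sum ?c {..<Suc (m + Suc p)} - sum ?c {..<Suc m} =
      (sum ?c {..<Suc (m + p)} - sum ?c {..<Suc m}) + ?c (Suc (m + p))"
    by simp
  ultimately show ?case
    using Suc.IH norm_triangle_ineq[of "sum ?c {..<Suc (m + p)} - sum ?c {..<Suc m}" "?c (Suc (m + p))"]
    by (smt (verit) add_Suc_right)
qed

lemma norm_binomial_partial_sum_le:
  assumes "0 \<le> \<alpha>" "\<alpha> \<le> 1" "norm z < 1"
  shows "norm (\<Sum>k<Suc m. (complex_of_real \<alpha> gchoose k) * z ^ k) \<le> norm (1 + z) powr \<alpha> + R \<alpha> m"
proof -
  let ?S = "\<lambda>N. \<Sum>k<N. (complex_of_real \<alpha> gchoose k) * z ^ k"
  have "?S \<longlonglongrightarrow> (1 + z) powr complex_of_real \<alpha>"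
    using gen_binomial_complex[OF assms(3)] by (simp add: sums_def)
  then have "(\<lambda>p. ?S (p + Suc m)) \<longlonglongrightarrow> (1 + z) powr complex_of_real \<alpha>"
    by (rule LIMSEQ_ignore_initial_segment)
  then have lim: "(\<lambda>p. norm (?S (p + Suc m)) + R \<alpha> m) \<longlonglongrightarrow>
               norm ((1 + z) powr complex_of_real \<alpha>) + R \<alpha> m"
    by (intro tendsto_intros)
  have "norm (?S (Suc m)) \<le> norm (?S (p + Suc m)) + R \<alpha> m" for p
  proof -
    have "norm (?S (Suc (m + p)) - ?S (Suc m)) \<le> R \<alpha> m - R \<alpha> (m + p)"
      using assms by (intro binomial_partial_sums_diff) auto
    \<comment> \<open>Dropping \<open>R \<alpha> (m + p)\<close> gives a bound uniform in
      \<open>p\<close>, so the limit of \<open>R\<close> need not be known.\<close>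
    then have "norm (?S (p + Suc m) - ?S (Suc m)) \<le> R \<alpha> m"
      using R_nonneg[OF assms(2), of "m + p"] by (simp add: add.commute del: sum.lessThan_Suc)
    then show ?thesis
      using norm_triangle_ineq2[of "?S (Suc m)" "?S (p + Suc m)"]
      by (simp add: norm_minus_commute del: sum.lessThan_Suc)
  qed
  then have "norm (?S (Suc m)) \<le> norm ((1 + z) powr complex_of_real \<alpha>) + R \<alpha> m"
    by (intro LIMSEQ_le_const[OF lim]) auto
  also have "norm ((1 + z) powr complex_of_real \<alpha>) = norm (1 + z) powr \<alpha>"
    by (simp add: norm_powr_real_powr')
  finally show ?thesis .
qed

lemma norm_A_coeff_le:
  assumes "0 \<le> \<alpha>" "\<alpha> \<le> 1" "norm x = 1" "norm (1 + x) \<le> 1"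
  shows "norm (A_coeff m \<alpha> x) \<le> 1 + R \<alpha> m"
proof -
  let ?S = "\<lambda>r. \<Sum>k<Suc m. (complex_of_real \<alpha> gchoose k) * (complex_of_real r * x) ^ k"
  have "((\<lambda>r. norm (?S r)) \<longlongrightarrow> norm (?S 1)) (at_left 1)"
    by (intro tendsto_intros)
  moreover have "eventually (\<lambda>r::real. r \<in> {0<..<1}) (at_left 1)"
    by (rule eventually_at_left_real) simp
  then have "eventually (\<lambda>r. norm (?S r) \<le> 1 + R \<alpha> m) (at_left 1)"
  proof eventually_elim
    case (elim r)
    then have r: "0 < r" "r < 1" by auto
    \<comment> \<open>A convex combination of 1 and \<open>1 + x\<close>, both in the closed unit
      disc.\<close>
    have "1 + of_real r * x = of_real (1 - r) + of_real r * (1 + x)"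
      by (simp add: algebra_simps)
    also have "norm \<dots> \<le> norm (complex_of_real (1 - r)) + norm (complex_of_real r * (1 + x))"
      by (rule norm_triangle_ineq)
    also have "\<dots> \<le> (1 - r) + r * 1"
      using r assms(4) unfolding norm_mult norm_of_real
      by (intro add_mono mult_mono) auto
    finally have "norm (1 + of_real r * x) powr \<alpha> \<le> 1"
      using powr_le1[OF assms(1)] by simp
    moreover have "norm (?S r) \<le> norm (1 + of_real r * x) powr \<alpha> + R \<alpha> m"
      using r assms by (intro norm_binomial_partial_sum_le) (auto simp: norm_mult)
    ultimately show ?case by linarith
  qed
  ultimately have "norm (?S 1) \<le> 1 + R \<alpha> m"
    by (rule tendsto_upperbound) simp
  then show ?thesis
    by (simp add: A_coeff_eq_binomial_sum del: sum.lessThan_Suc)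
qed

text \<open>Beyond index 2 the terms pair up as (odd, even) with nonnegative sum, because the moduli
  decrease; the last, unpaired odd term is itself nonnegative.\<close>

lemma Re_A_coeff_odd_ge:
  assumes "0 \<le> \<alpha>" "\<alpha> \<le> 1" "1 \<le> p"
  shows "1 + \<alpha> * (1 + \<alpha>) / 2 \<le> Re (A_coeff (2 * p + 1) \<alpha> 1)"
proof -
  let ?S = "\<lambda>N. \<Sum>k<N. \<alpha> gchoose k"
  have even: "1 + \<alpha> * (1 + \<alpha>) / 2 \<le> ?S (Suc (2 * p))"
    using assms(3)
  proof (induction p rule: dec_induct)
    case base
    show ?case
      by (simp add: eval_nat_numeral gbinomial_Suc_eq_R_diff R_Suc field_simps)
  next
    case (step p)
    have "?S (Suc (2 * Suc p)) =
        ?S (Suc (2 * p)) + (\<alpha> gchoose Suc (2 * p)) + (\<alpha> gchoose Suc (Suc (2 * p)))"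
      by simp
    then show ?case
      using step.IH R_diff_antimono[OF assms(1,2), of "2 * p"]
      unfolding gbinomial_Suc_eq_R_diff by simp
  qed
  have "Re (A_coeff (2 * p + 1) \<alpha> 1) = ?S (Suc (2 * p + 1))"
    unfolding A_coeff_eq_binomial_sum gbinomial_of_real by (simp del: sum.lessThan_Suc)
  also have "\<dots> = ?S (Suc (2 * p)) + (\<alpha> gchoose Suc (2 * p))"
    by simp
  finally show ?thesis
    using even R_diff_nonneg[OF assms(1,2), of "2 * p"]
    unfolding gbinomial_Suc_eq_R_diff by simp
qed

text \<open>The cube matches the decay of order m to the power -1/3. The induction starts at 3, the
  first index where the constant 1/2 works.\<close>

lemma R_third_cube_le:
  assumes "3 \<le> m"
  shows "R (1/3) m ^ 3 \<le> 1 / (2 * (real m + 1))"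
  using assms
proof (induction m rule: dec_induct)
  case base
  show ?case by (simp add: eval_nat_numeral R_Suc)
next
  case (step m)
  define t where "t = real m + 1"
  have t: "t \<ge> 4" using step.hyps by (simp add: t_def)
  have "(1 - 1 / (3 * t)) ^ 3 * (t + 1) \<le> t"
  proof -
    \<comment> \<open>The claim multiplied by \<open>27 * t ^ 3\<close>.\<close>
    have "27 * t ^ 4 - (3 * t - 1) ^ 3 * (t + 1) = 18 * t\<^sup>2 - 8 * t + 1"
      by (simp add: power2_eq_square power3_eq_cube power4_eq_xxxx algebra_simps)
    also have "\<dots> \<ge> 0"
      using mult_right_mono[of 4 t t] t by (simp add: power2_eq_square)
    finally show ?thesis
      using t by (simp add: field_simps power3_eq_cube power4_eq_xxxx)
  qed
  then have le: "(1 - 1 / (3 * t)) ^ 3 \<le> t / (t + 1)"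
    using t by (simp add: pos_le_divide_eq)
  have "R (1/3) (Suc m) ^ 3 = R (1/3) m ^ 3 * (1 - 1 / (3 * t)) ^ 3"
    by (simp add: R_Suc t_def power_mult_distrib add.commute)
  also have "\<dots> \<le> 1 / (2 * t) * (t / (t + 1))"
    using step.IH le t
    by (intro mult_mono) (auto simp: t_def field_simps)
  also have "\<dots> = 1 / (2 * (t + 1))"
    using t by simp
  finally show ?case by (simp add: t_def add.commute)
qed

lemma R_le_two_ninths:
  assumes "1/3 \<le> \<alpha>" "\<alpha> \<le> 1" "53 \<le> m"
  shows "R \<alpha> m \<le> 2 / 9"
proof -
  have "R (1/3) m ^ 3 \<le> 1 / (2 * (real m + 1))"
    using assms(3) by (intro R_third_cube_le) simp
  \<comment> \<open>For \<open>m\<close> at least 53 the left side is at most 1/108, below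
    8/729.\<close>
  also have "\<dots> \<le> (2 / 9) ^ 3"
    using assms(3) by (simp add: field_simps)
  finally have "R (1/3) m \<le> 2 / 9"
    by (subst (asm) power_mono_iff) (auto simp: R_nonneg)
  with R_antimono[OF assms(1,2), of m] show ?thesis by linarith
qed

lemma norm_one_plus_cis_le_1:
  assumes "cos \<theta> \<le> - 1 / 2"
  shows "norm (1 + cis \<theta>) \<le> 1"
proof -
  have "(norm (1 + cis \<theta>))\<^sup>2 = 1 + 2 * cos \<theta> + ((cos \<theta>)\<^sup>2 + (sin \<theta>)\<^sup>2)"
    unfolding cmod_power2 by (simp add: power2_sum)
  also have "\<dots> \<le> 1"
    using assms by simp
  finally show ?thesis
    by (simp add: abs_square_le_1)
qed

theorem theorem3:
  fixes n :: nat and \<alpha> :: real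
  assumes "n \<ge> 27"
    and "\<alpha> \<in> {1/3..<1}"
  shows "\<forall>\<theta> \<in> {-pi..-(2*pi/3)} \<union> {2*pi/3..pi}.
           Re (A_coeff (2*n - 1) \<alpha> 1) \<ge> cmod (A_coeff (2*n - 1) \<alpha> (exp (\<i> * complex_of_real \<theta>)))"
proof
  fix \<theta> assume \<theta>: "\<theta> \<in> {-pi..-(2*pi/3)} \<union> {2*pi/3..pi}"
  have \<alpha>: "1/3 \<le> \<alpha>" "\<alpha> \<le> 1" "0 \<le> \<alpha>"
    using assms(2) by auto
  \<comment> \<open>Evenness of cosine treats both intervals at once.\<close>
  have "cos \<bar>\<theta>\<bar> \<le> cos (2 * pi / 3)"
    using \<theta> by (intro cos_monotone_0_pi_le) auto
  then have "norm (1 + cis \<theta>) \<le> 1"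
    by (intro norm_one_plus_cis_le_1) (simp add: cos_120)
  then have "norm (A_coeff (2*n - 1) \<alpha> (cis \<theta>)) \<le> 1 + R \<alpha> (2*n - 1)"
    using \<alpha> by (intro norm_A_coeff_le) auto
  also have "\<dots> \<le> 11 / 9"
    using R_le_two_ninths[OF \<alpha>(1,2), of "2*n - 1"] assms(1) by simp
  \<comment> \<open>11/9 is the value of the right side at \<alpha> = 1/3.\<close>
  also have "\<dots> \<le> 1 + \<alpha> * (1 + \<alpha>) / 2"
    using mult_mono[of "1/3" \<alpha> "4/3" "1 + \<alpha>"] \<alpha> by simp
  also have "\<dots> \<le> Re (A_coeff (2 * (n - 1) + 1) \<alpha> 1)"
    using \<alpha> assms(1) by (intro Re_A_coeff_odd_ge) auto
  also have "2 * (n - 1) + 1 = 2 * n - 1"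
    using assms(1) by simp
  finally show "Re (A_coeff (2*n - 1) \<alpha> 1) \<ge> cmod (A_coeff (2*n - 1) \<alpha> (exp (\<i> * complex_of_real \<theta>)))"
    by (simp add: cis_conv_exp)
qed

end
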